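(* For each $x\in X$, $$\mathcal{K}(x)=\bigcup_{J\in\mathcal{P}}\mathcal{K}_J(x).$$
   Context: Setting: $x=(x_1,\dots,x_n)\in\mathbb{R}^n$ and $u=(u_1,\dots,u_p)\in\mathbb{R}^p$; $X\subseteq\mathbb{R}^n$ is a semialgebraic set; $f(x)$ and $g(x,u)$ are real polynomials ($g$ scalar valued); $A=[a_1\ \cdots\ a_m]^T\in\mathbb{R}^{m\times p}$ is a constant matrix with rows $a_j^T$; $b(x)=(b_1(x),\dots,b_m(x))^T$ is a vector of real polynomials; $U(x)=\{u\in\mathbb{R}^p: Au\ge b(x)\}$ (componentwise inequality). It is assumed that $U$ is locally bounded on $X$: for every $\hat x\in X$ there are a neighborhood $C_1$ of $\hat x$ and a bounded set $C_2$ with $U(x)\subseteq C_2$ for all $x\in C_1$. Notation: $[m]=\{1,\dots,m\}$, $r=\operatorname{rank}(A)$. For $J=\{j_1,\dots,j_r\}\subseteq[m]$, $A_J=[a_{j_1}\ \cdots\ a_{j_r}]^T$ and $b_J(x)=(b_{j_1}(x),\dots,b_{j_r}(x))^T$. $\mathcal{P}=\{J\subseteq[m]: \operatorname{rank}(A_J)=|J|=r\}$. The notation $0\le v\perp w\ge 0$ means $v\ge0$, $w\ge0$ and $v^Tw=0$. The KKT set is $$\mathcal{K}(x)=\{u\in\mathbb{R}^p:\ \exists\lambda\in\mathbb{R}^m\text{ with }\nabla_u g(x,u)-A^T\lambda=0,\ 0\le Au-b(x)\perp\lambda\ge0\}.$$ For $J\in\mathcal{P}$, the $J$th KKT subset is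 $$\mathcal{K}_J(x)=\{u\in U(x):\ \exists\lambda_J=(\lambda_j)_{j\in J}\in\mathbb{R}^r\text{ with }\nabla_u g(x,u)-A_J^T\lambda_J=0,\ 0\le A_Ju-b_J(x)\perp\lambda_J\ge0\}.$$ *)

theory Defs
  imports "HOL-Analysis.Analysis"
begin

definition basic_semialgebraic :: "'a::euclidean_space set \<Rightarrow> bool" where
  "basic_semialgebraic S \<longleftrightarrow>
     (\<exists>P Q. finite P \<and> finite Q \<and> (\<forall>p\<in>P \<union> Q. real_polynomial_function p) \<and>
            S = {x. (\<forall>p\<in>P. p x = 0) \<and> (\<forall>q\<in>Q. 0 < q x)})"

definition semialgebraic :: "'a::euclidean_space set \<Rightarrow> bool" where
  "semialgebraic S \<longleftrightarrow>
     (\<exists>\<S>. finite \<S> \<and> (\<forall>T\<in>\<S>. basic_semialgebraic T) \<and> S = \<Union>\<S>)"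

definition gradient :: "('a::real_inner \<Rightarrow> real) \<Rightarrow> 'a \<Rightarrow> 'a" where
  "gradient h v = (THE D. GDERIV h v :> D)"

lemma gradient_eqI:
  assumes "GDERIV h v :> D"
  shows "gradient h v = D"
  unfolding gradient_def
proof (rule the_equality)
  fix D' assume "GDERIV h v :> D'"
  then have "(\<lambda>k. k \<bullet> D') = (\<lambda>k. k \<bullet> D)"
    using assms unfolding gderiv_def by (rule has_derivative_unique)
  then show "D' = D"
    by (metis vector_eq_ldot)
qed (rule assms)

lemma gradient_real_polynomial_function:
  fixes h :: "'a::euclidean_space \<Rightarrow> real"
  assumes "real_polynomial_function h"
  shows "GDERIV h v :> gradient h v"
proof -
  have "h differentiable (at v)"
    using assms by (simp add: differentiable_at_polynomial_function real_polynomial_function_eq)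
  then obtain h' where h': "(h has_derivative h') (at v)"
    by (auto simp: differentiable_def)
  have "h' = (\<lambda>k. k \<bullet> adjoint h' 1)"
    using adjoint_works[OF has_derivative_linear[OF h'], of _ 1] by (simp add: fun_eq_iff)
  with h' have "GDERIV h v :> adjoint h' 1"
    by (simp add: gderiv_def)
  then show ?thesis
    by (simp add: gradient_eqI)
qed

text \<open>
  For a subset J of the index type \<open>'m\<close>, the space of real vectors indexed by J is
  identified with the vectors of \<open>real^'m\<close> that vanish outside J. Accordingly, \<open>vec_sub\<close>
  and \<open>row_sub\<close> render the subvector \<open>b\<^sub>J\<close> and the submatrix \<open>A\<^sub>J\<close> by setting the entries,
  respectively rows, outside J to zero; this changes neither the rank nor the products
  with \<open>A\<^sub>J\<close> and its transpose, as the three lemmas below record.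
\<close>

definition coord_space :: "'m::finite set \<Rightarrow> (real^'m) set" where
  "coord_space J = {v. \<forall>j. j \<notin> J \<longrightarrow> v $ j = 0}"

definition vec_sub :: "real^'m::finite \<Rightarrow> 'm set \<Rightarrow> real^'m" where
  "vec_sub v J = (\<chi> j. if j \<in> J then v $ j else 0)"

definition row_sub :: "real^'p::finite^'m::finite \<Rightarrow> 'm set \<Rightarrow> real^'p^'m" where
  "row_sub A J = (\<chi> j. if j \<in> J then row j A else 0)"

lemma rank_row_sub: "rank (row_sub A J) = dim ((\<lambda>j. row j A) ` J)"
proof -
  have rows: "rows (row_sub A J) = (\<lambda>j. if j \<in> J then row j A else 0) ` UNIV"
  proof -
    have "row i (row_sub A J) = (if i \<in> J then row i A else 0)" for i
      by (simp add: row_sub_def row_def vec_eq_iff)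
    then show ?thesis
      by (auto simp: rows_def)
  qed
  have "span (rows (row_sub A J)) = span ((\<lambda>j. row j A) ` J)"
  proof (rule span_eq[THEN iffD2], intro conjI)
    show "rows (row_sub A J) \<subseteq> span ((\<lambda>j. row j A) ` J)"
      by (auto simp: rows span_zero intro: span_base)
    show "(\<lambda>j. row j A) ` J \<subseteq> span (rows (row_sub A J))"
      by (auto simp: rows intro!: span_base image_eqI)
  qed
  then show ?thesis
    by (metis row_rank_def dim_span)
qed

lemma row_sub_mult_vec: "row_sub A J *v u = vec_sub (A *v u) J"
  by (simp add: row_sub_def vec_sub_def vec_eq_iff matrix_vector_mult_def row_def)

lemma transpose_row_sub_mult_vec:
  "transpose (row_sub A J) *v l = (\<Sum>j\<in>J. l $ j *\<^sub>R row j A)"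
proof -
  have "(\<Sum>j\<in>UNIV. (if j \<in> J then row j A else 0) $ i * l $ j) = (\<Sum>j\<in>J. l $ j * row j A $ i)" for i
    by (rule sum.mono_neutral_cong_right) auto
  then show ?thesis
    by (simp add: vec_eq_iff matrix_vector_mult_def transpose_def row_sub_def)
qed

text \<open>On \<open>real^'m\<close> the order is the componentwise one.\<close>

definition complementary :: "real^'m::finite \<Rightarrow> real^'m \<Rightarrow> bool" where
  "complementary v w \<longleftrightarrow> 0 \<le> v \<and> 0 \<le> w \<and> v \<bullet> w = 0"

definition feasible_set ::
  "real^'p::finite^'m::finite \<Rightarrow> ('x \<Rightarrow> real^'m) \<Rightarrow> 'x \<Rightarrow> (real^'p) set" where
  "feasible_set A b x = {u. b x \<le> A *v u}"

definition locally_bounded_on ::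
  "'a::topological_space set \<Rightarrow> ('a \<Rightarrow> 'b::metric_space set) \<Rightarrow> bool" where
  "locally_bounded_on X U \<longleftrightarrow>
     (\<forall>x\<in>X. \<exists>C\<^sub>1 C\<^sub>2. x \<in> interior C\<^sub>1 \<and> bounded C\<^sub>2 \<and> (\<forall>y\<in>C\<^sub>1. U y \<subseteq> C\<^sub>2))"

definition row_bases :: "real^'p::finite^'m::finite \<Rightarrow> 'm set set" where
  "row_bases A = {J. rank (row_sub A J) = card J \<and> card J = rank A}"

definition KKT ::
  "('x \<Rightarrow> real^'p::finite \<Rightarrow> real) \<Rightarrow> real^'p^'m::finite \<Rightarrow> ('x \<Rightarrow> real^'m) \<Rightarrow> 'x \<Rightarrow> (real^'p) set"
where
  "KKT g A b x =
     {u. \<exists>l. gradient (g x) u - transpose A *v l = 0 \<and> complementary (A *v u - b x) l}"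

definition KKT_sub ::
  "('x \<Rightarrow> real^'p::finite \<Rightarrow> real) \<Rightarrow> real^'p^'m::finite \<Rightarrow> ('x \<Rightarrow> real^'m) \<Rightarrow> 'm set \<Rightarrow> 'x
     \<Rightarrow> (real^'p) set"
where
  "KKT_sub g A b J x =
     {u \<in> feasible_set A b x.
        \<exists>l\<in>coord_space J. gradient (g x) u - transpose (row_sub A J) *v l = 0 \<and>
                          complementary (row_sub A J *v u - vec_sub (b x) J) l}"

end

theory Submission
  imports Defs
begin

text \<open>
  If \<open>u\<close> is a KKT point, the gradient lies in the cone of the rows active at \<open>u\<close>. By the conic
  Caratheodory theorem it is a nonnegative combination of linearly independent active rows, and
  these extend to a basis of the row space of \<open>A\<close>; setting the new multipliers to zero keeps
  complementarity, and feasibility of \<open>u\<close> takes care of the possibly inactive new rows.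
\<close>

text \<open>Dependence is meant for indexed families, so two indices carrying the same vector
  already count; the rows of a matrix may repeat. The positive coefficient guarantees that the
  minimal ratio in \<open>conic_caratheodory\<close> exists.\<close>

lemma family_dependent_positive_coefficient:
  fixes v :: "'i \<Rightarrow> 'a::real_vector"
  assumes "finite S" and "\<not> (inj_on v S \<and> independent (v ` S))"
  obtains e where "(\<Sum>j\<in>S. e j *\<^sub>R v j) = 0" and "\<exists>j\<in>S. 0 < e j"
proof -
  have "\<exists>e. (\<Sum>j\<in>S. e j *\<^sub>R v j) = 0 \<and> (\<exists>j\<in>S. e j \<noteq> 0)"
  proof (cases "inj_on v S")
    case True
    with assms obtain w where w: "\<exists>y\<in>v ` S. w y \<noteq> 0" "(\<Sum>y\<in>v ` S. w y *\<^sub>R y) = 0"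
      using real_vector.dependent_finite[of "v ` S"] by auto
    then show ?thesis
      using True by (intro exI[of _ "w \<circ> v"]) (auto simp: sum.reindex)
  next
    case False
    then obtain i k where ik: "i \<in> S" "k \<in> S" "v i = v k" "i \<noteq> k"
      by (auto simp: inj_on_def)
    \<comment> \<open>Opposite weights on two indices with the same vector cancel.\<close>
    define e :: "'i \<Rightarrow> real" where "e j = (if j = i then 1 else 0) - (if j = k then 1 else 0)" for j
    have "(\<Sum>j\<in>S. e j *\<^sub>R v j) =
        (\<Sum>j\<in>S. if j = i then v j else 0) - (\<Sum>j\<in>S. if j = k then v j else 0)"
      unfolding sum_subtractf[symmetric] by (intro sum.cong) (auto simp: e_def)
    also have "\<dots> = 0"
      using ik assms(1) by simp
    finally show ?thesis
      using ik by (intro exI[of _ e]) (auto simp: e_def)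
  qed
  then obtain e i where e: "(\<Sum>j\<in>S. e j *\<^sub>R v j) = 0" "i \<in> S" "e i \<noteq> 0"
    by blast
  show thesis
  proof (cases "0 < e i")
    case True
    with e that show ?thesis by blast
  next
    case False
    \<comment> \<open>Negating a linear relation gives another one, so the sign of one nonzero
      coefficient can be chosen.\<close>
    with e show ?thesis
      by (intro that[of "\<lambda>j. - e j"]) (auto simp: sum_negf intro!: bexI[of _ i])
  qed
qed

lemma conic_caratheodory:
  fixes v :: "'i \<Rightarrow> 'a::real_vector"
  assumes "finite S" and "\<And>j. j \<in> S \<Longrightarrow> 0 \<le> c j"
  shows "\<exists>T d. T \<subseteq> S \<and> inj_on v T \<and> independent (v ` T) \<and> (\<forall>j\<in>T. 0 \<le> d j) \<and>
    (\<Sum>j\<in>T. d j *\<^sub>R v j) = (\<Sum>j\<in>S. c j *\<^sub>R v j)"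
  using assms
proof (induction S arbitrary: c rule: finite_psubset_induct)
  case (psubset S)
  show ?case
  proof (cases "inj_on v S \<and> independent (v ` S)")
    case True
    then show ?thesis
      using psubset.prems by blast
  next
    case False
    then obtain e where e: "(\<Sum>j\<in>S. e j *\<^sub>R v j) = 0" "\<exists>j\<in>S. 0 < e j"
      using family_dependent_positive_coefficient psubset.hyps by blast
    define P where "P = {j\<in>S. 0 < e j}"
    have "finite P" "P \<noteq> {}"
      using psubset.hyps e by (auto simp: P_def)
    then obtain k where k: "k \<in> P" and k_min: "\<And>j. j \<in> P \<Longrightarrow> c k / e k \<le> c j / e j"
      using ex_is_arg_min_if_finite[of P "\<lambda>j. c j / e j"]
      by (auto simp: is_arg_min_linorder)
    \<comment> \<open>The least ratio is the largest step for which every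
      \<open>c j - t * e j\<close> stays nonnegative, and the value at \<open>k\<close> becomes
      zero. Where \<open>e j\<close> is not positive, the coefficient does not decrease, since
      \<open>t\<close> is nonnegative.\<close>
    define t where "t = c k / e k"
    define c' where "c' j = c j - t * e j" for j
    have kS: "k \<in> S" "0 < e k"
      using k by (auto simp: P_def)
    then have t: "0 \<le> t" and c'k: "c' k = 0"
      using psubset.prems by (auto simp: t_def c'_def)
    have c': "0 \<le> c' j" if "j \<in> S" for j
    proof (cases "0 < e j")
      case True
      with that k_min[of j] show ?thesis
        by (simp add: P_def c'_def t_def pos_le_divide_eq)
    next
      case False
      then have "t * e j \<le> 0"
        using t by (simp add: mult_nonneg_nonpos)
      with psubset.prems[OF that] show ?thesis
        by (simp add: c'_def)
    qed
    have "(\<Sum>j\<in>S - {k}. c' j *\<^sub>R v j) = (\<Sum>j\<in>S. c' j *\<^sub>R v j)"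
      using psubset.hyps kS c'k by (simp add: sum.remove)
    also have "\<dots> = (\<Sum>j\<in>S. c j *\<^sub>R v j) - t *\<^sub>R (\<Sum>j\<in>S. e j *\<^sub>R v j)"
      by (simp add: c'_def scaleR_diff_left sum_subtractf scaleR_sum_right)
    finally have "(\<Sum>j\<in>S - {k}. c' j *\<^sub>R v j) = (\<Sum>j\<in>S. c j *\<^sub>R v j)"
      using e by simp
    moreover have "S - {k} \<subset> S"
      using kS by blast
    moreover have "\<And>j. j \<in> S - {k} \<Longrightarrow> 0 \<le> c' j"
      using c' by blast
    ultimately obtain T d where "T \<subseteq> S - {k}" "inj_on v T" "independent (v ` T)"
      "\<forall>j\<in>T. 0 \<le> d j" "(\<Sum>j\<in>T. d j *\<^sub>R v j) = (\<Sum>j\<in>S. c j *\<^sub>R v j)"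
      using psubset.IH[of "S - {k}" c'] by auto
    then show ?thesis
      by (intro exI[of _ T] exI[of _ d]) auto
  qed
qed

text \<open>The set of vectors is first extended to a basis \<open>B\<close> of the span of all of
  them. Then exactly one index is chosen for each vector of \<open>B\<close> outside the image of
  \<open>T\<close>, which keeps the family injective.\<close>

lemma independent_family_extend:
  fixes v :: "'i \<Rightarrow> 'a::real_vector"
  assumes "inj_on v T" and "independent (v ` T)"
  obtains J where "T \<subseteq> J" and "inj_on v J" and "independent (v ` J)" and "range v \<subseteq> span (v ` J)"
proof -
  obtain B where B: "v ` T \<subseteq> B" "B \<subseteq> range v" "independent B" "range v \<subseteq> span B"
    using maximal_independent_subset_extend[of "v ` T" "range v"] assms by blast
  obtain K where K: "inj_on v K" "v ` K = B - v ` T"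
    by (metis B(2) Diff_subset order_trans subset_image_inj)
  have "v ` (T \<union> K) = B"
    using B(1) K(2) by blast
  moreover have "inj_on v (T \<union> K)"
    using assms(1) K by (auto simp: inj_on_Un)
  ultimately show thesis
    using that[of "T \<union> K"] B by auto
qed

text \<open>The members of \<open>row_bases A\<close> arise from bases of the row space: an
  injective independent family has rank \<open>card J\<close>, and spanning all rows makes this the
  rank of \<open>A\<close>.\<close>

lemma row_basesI:
  fixes A :: "real^'p::finite^'m::finite"
  assumes "inj_on (\<lambda>j. row j A) J" and "independent ((\<lambda>j. row j A) ` J)"
    and "range (\<lambda>j. row j A) \<subseteq> span ((\<lambda>j. row j A) ` J)"
  shows "J \<in> row_bases A"
proof -
  have "rank (row_sub A J) = card J"
    using assms by (simp add: rank_row_sub dim_eq_card_independent card_image)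
  moreover have "rank A = dim ((\<lambda>j. row j A) ` J)"
  proof -
    have "span (range (\<lambda>j. row j A)) = span ((\<lambda>j. row j A) ` J)"
      using assms(3) by (auto simp: span_eq intro: span_base)
    moreover have "rows A = range (\<lambda>j. row j A)"
      by (auto simp: rows_def)
    ultimately show ?thesis
      by (metis row_rank_def dim_span)
  qed
  ultimately show ?thesis
    by (simp add: row_bases_def rank_row_sub)
qed

lemma transpose_mult_vec_rows:
  fixes A :: "real^'p::finite^'m::finite"
  assumes "l \<in> coord_space J"
  shows "transpose A *v l = (\<Sum>j\<in>J. l $ j *\<^sub>R row j A)"
proof -
  have "row_sub A UNIV = A"
    by (simp add: row_sub_def row_def vec_eq_iff)
  then have "transpose A *v l = (\<Sum>j\<in>UNIV. l $ j *\<^sub>R row j A)"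
    using transpose_row_sub_mult_vec[of A UNIV l] by simp
  also have "\<dots> = (\<Sum>j\<in>J. l $ j *\<^sub>R row j A)"
    using assms by (intro sum.mono_neutral_right) (auto simp: coord_space_def)
  finally show ?thesis .
qed

text \<open>Under the sign conditions the inner product is a sum of nonnegative terms, so it
  vanishes only if each term does.\<close>

lemma complementary_iff:
  "complementary v w \<longleftrightarrow> (\<forall>j. 0 \<le> v $ j \<and> 0 \<le> w $ j \<and> v $ j * w $ j = 0)"
proof -
  have "v \<bullet> w = 0 \<longleftrightarrow> (\<forall>j. v $ j * w $ j = 0)" if "0 \<le> v" "0 \<le> w"
    using that by (simp add: inner_vec_def less_eq_vec_def sum_nonneg_eq_0_iff)
  then show ?thesis
    by (auto simp: complementary_def less_eq_vec_def)
qed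

text \<open>The same multiplier serves for the full system: outside \<open>J\<close> it is zero, so
  complementarity holds there, and the slack is nonnegative by feasibility of
  \<open>u\<close>.\<close>

lemma KKT_sub_subset_KKT: "KKT_sub g A b J x \<subseteq> KKT g A b x"
proof
  fix u assume "u \<in> KKT_sub g A b J x"
  then obtain l where feas: "b x \<le> A *v u" and l: "l \<in> coord_space J"
    and grad: "gradient (g x) u - transpose (row_sub A J) *v l = 0"
    and compl: "complementary (row_sub A J *v u - vec_sub (b x) J) l"
    by (auto simp: KKT_sub_def feasible_set_def)
  have "transpose A *v l = transpose (row_sub A J) *v l"
    by (metis transpose_row_sub_mult_vec transpose_mult_vec_rows l)
  moreover have "complementary (A *v u - b x) l"
    unfolding complementary_iff
  proof
    fix j
    show "0 \<le> (A *v u - b x) $ j \<and> 0 \<le> l $ j \<and> (A *v u - b x) $ j * l $ j = 0"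
      using feas l compl[unfolded complementary_iff, rule_format, of j]
      by (cases "j \<in> J")
        (auto simp: less_eq_vec_def coord_space_def row_sub_mult_vec vec_sub_def)
  qed
  ultimately show "u \<in> KKT g A b x"
    unfolding KKT_def using grad by (intro CollectI exI[of _ l] conjI) simp_all
qed

lemma KKT_imp_KKT_sub:
  assumes "u \<in> KKT g A b x"
  shows "\<exists>J\<in>row_bases A. u \<in> KKT_sub g A b J x"
proof -
  obtain l where grad: "gradient (g x) u - transpose A *v l = 0"
    and "complementary (A *v u - b x) l"
    using assms by (auto simp: KKT_def)
  then have nonneg: "\<And>j. (b x) $ j \<le> (A *v u) $ j" "\<And>j. 0 \<le> l $ j"
    and active: "\<And>j. l $ j \<noteq> 0 \<Longrightarrow> (A *v u) $ j = (b x) $ j"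
    by (auto simp: complementary_iff)
  \<comment> \<open>By \<open>active\<close>, every constraint in the support of \<open>l\<close> is
    tight at \<open>u\<close>, so any combination of rows from \<open>S\<close> uses active rows
    only.\<close>
  define S where "S = {j. l $ j \<noteq> 0}"
  obtain T d where T: "T \<subseteq> S" "inj_on (\<lambda>j. row j A) T" "independent ((\<lambda>j. row j A) ` T)"
    and d: "\<forall>j\<in>T. 0 \<le> d j"
    and d_sum: "(\<Sum>j\<in>T. d j *\<^sub>R row j A) = (\<Sum>j\<in>S. l $ j *\<^sub>R row j A)"
    using conic_caratheodory[of S "\<lambda>j. l $ j" "\<lambda>j. row j A"] nonneg(2) by auto
  obtain J where "T \<subseteq> J" and J: "J \<in> row_bases A"
    using independent_family_extend[OF T(2,3)] row_basesI by metis
  \<comment> \<open>Rows in \<open>J - T\<close> may be inactive at \<open>u\<close>, hence the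
    default value zero. Rows in \<open>T\<close> are active because \<open>T\<close> lies in
    \<open>S\<close>, so their weights \<open>d j\<close> meet a zero slack.\<close>
  define l' where "l' = (\<chi> j. if j \<in> T then d j else 0)"
  have l': "l' \<in> coord_space J"
    using \<open>T \<subseteq> J\<close> by (auto simp: l'_def coord_space_def)
  have "transpose (row_sub A J) *v l' = (\<Sum>j\<in>T. d j *\<^sub>R row j A)"
    unfolding transpose_row_sub_mult_vec
    using \<open>T \<subseteq> J\<close> by (intro sum.mono_neutral_cong_right) (auto simp: l'_def)
  also have "\<dots> = transpose A *v l"
    unfolding d_sum by (rule transpose_mult_vec_rows[symmetric]) (simp add: coord_space_def S_def)
  finally have "gradient (g x) u - transpose (row_sub A J) *v l' = 0"
    using grad by simp
  moreover have "complementary (row_sub A J *v u - vec_sub (b x) J) l'"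
    using nonneg active d T(1)
    by (auto simp: complementary_iff row_sub_mult_vec vec_sub_def l'_def S_def)
  moreover have "u \<in> feasible_set A b x"
    using nonneg by (simp add: feasible_set_def less_eq_vec_def)
  ultimately show ?thesis
    using J l' by (auto simp: KKT_sub_def)
qed

theorem theorem3p4:
  fixes X :: "(real^'n::finite) set"
    and f :: "real^'n \<Rightarrow> real"
    and g :: "real^'n \<Rightarrow> real^'p::finite \<Rightarrow> real"
    and A :: "real^'p^'m::finite"
    and b :: "real^'n \<Rightarrow> real^'m"
  assumes "semialgebraic X"
    and "real_polynomial_function f"
    and "real_polynomial_function (\<lambda>(x, u). g x u)"
    and "\<And>j. real_polynomial_function (\<lambda>x. b x $ j)"
    and "locally_bounded_on X (feasible_set A b)"
    and "x \<in> X"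
  shows "KKT g A b x = (\<Union>J\<in>row_bases A. KKT_sub g A b J x)"
proof
  show "KKT g A b x \<subseteq> (\<Union>J\<in>row_bases A. KKT_sub g A b J x)"
    by (intro subsetI UN_iff[THEN iffD2] KKT_imp_KKT_sub)
  show "(\<Union>J\<in>row_bases A. KKT_sub g A b J x) \<subseteq> KKT g A b x"
    by (intro UN_least KKT_sub_subset_KKT)
qed

end
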